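(* Let $1\le q\le2$, let $q'$ satisfy $1/q+1/q'=1$ (with $q'=\infty$ if $q=1$), and let $g\in L_q(P_0)$. Consider the model of densities $p_\lambda=p_0(1+\lambda)$ with deviation parameter $\lambda$, parameter space $\Lambda=L_{q'}(P_0)$, tangent space $\mathcal{T}=L_{q'}(P_0)$, and parameter of interest $\beta_0=\operatorname{E}_0[g(X)]=\psi(0)$, where $\psi(\lambda)=\int g(1+\lambda)p_0\,d\mu$. Then the semiparametric Fisher information $\mathcal{I}$ for $\beta_0$ satisfies $\mathcal{I}>0$ if and only if $g\in L_2(P_0)$ (that is, the transformation $g$ has finite variance).
   Context: $P_0$ is a probability measure on a measurable space $(\mathcal{X},\mathcal{B})$ with density $p_0$ with respect to a $\sigma$-finite measure $\mu$; $X$ has distribution $P_0$ and $\operatorname{E}_0$ is expectation under $P_0$. $g\colon\mathcal{X}\to\mathbb{R}$ is a measurable function. $L_r(P_0)$ is the usual Lebesgue space with norm $\|\cdot\|_r$. In this model the true parameter is $\lambda_0=0$; the score operator is the inclusion $A\colon L_{q'}(P_0)\to L_2(P_0)$, $A\alpha=\alpha$; and the gradient of $\psi$ at $0$ is the continuous linear functional $\dot\psi\colon L_{q'}(P_0)\to\mathbb{R}$, $\dot\psi\alpha=\int\alpha g\,p_0\,d\mu$. Semiparametric Fisher information: $\mathcal{I}=\inf_\alpha\|A\alpha\|_2^2/|\dot\psi\alpha|^2$, the infimum being over $\alpha\in\mathcal{T}$ with $\dot\psi\alpha\ne0$ (infimum of the empty set is $+\infty$). *)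

theory Defs
  imports "HOL-Probability.Probability" "HOL-Probability.Essential_Supremum"
begin

section \<open>Lebesgue spaces\<close>

text \<open>The exponent is extended, \<open>r = \<infinity>\<close> giving the essential supremum norm; it is meant for
  \<open>r \<ge> 1\<close>. The outer \<open>1/r\<close>-th root is taken in the reals and extended by \<open>\<infinity>\<close>, so that
  the norm of a function outside the space is \<open>\<infinity>\<close>. The elements of \<open>lp_space\<close> are functions
  rather than their almost-everywhere classes; all quantities formed from them below are
  invariant under changes on null sets.\<close>

definition lp_norm :: "'a measure \<Rightarrow> ennreal \<Rightarrow> ('a \<Rightarrow> real) \<Rightarrow> ennreal" where
  "lp_norm M r f =
     (if r = \<infinity> then esssup M (\<lambda>x. ennreal \<bar>f x\<bar>)
      else (let I = (\<integral>\<^sup>+ x. ennreal (\<bar>f x\<bar> powr enn2real r) \<partial>M)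
            in if I = \<infinity> then \<infinity> else ennreal (enn2real I powr (1 / enn2real r))))"

definition lp_space :: "'a measure \<Rightarrow> ennreal \<Rightarrow> ('a \<Rightarrow> real) set" where
  "lp_space M r = {f \<in> borel_measurable M. lp_norm M r f < \<infinity>}"

lemma lp_space_finite_exponent:
  assumes "r \<noteq> \<infinity>"
  shows "f \<in> lp_space M r \<longleftrightarrow>
    f \<in> borel_measurable M \<and> integrable M (\<lambda>x. \<bar>f x\<bar> powr enn2real r)"
  using assms
  by (auto simp: lp_space_def lp_norm_def Let_def integrable_iff_bounded less_top split: if_splits)

lemma lp_space_2:
  "f \<in> lp_space M 2 \<longleftrightarrow> f \<in> borel_measurable M \<and> integrable M (\<lambda>x. (f x)\<^sup>2)"
proof -
  have "\<bar>y\<bar> powr 2 = y\<^sup>2" for y :: real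
    by (cases "y = 0") (auto simp: powr_numeral)
  then show ?thesis
    by (subst lp_space_finite_exponent) (auto simp: enn2real_numeral)
qed

lemma lp_space_infinite_exponent:
  assumes "f \<in> borel_measurable M"
  shows "f \<in> lp_space M \<infinity> \<longleftrightarrow> (\<exists>C. AE x in M. \<bar>f x\<bar> \<le> C)"
proof
  assume "f \<in> lp_space M \<infinity>"
  then have fin: "esssup M (\<lambda>x. ennreal \<bar>f x\<bar>) < \<infinity>"
    by (simp add: lp_space_def lp_norm_def)
  have "AE x in M. ennreal \<bar>f x\<bar> \<le> esssup M (\<lambda>x. ennreal \<bar>f x\<bar>)"
    by (rule esssup_AE)
  then have "AE x in M. \<bar>f x\<bar> \<le> enn2real (esssup M (\<lambda>x. ennreal \<bar>f x\<bar>))"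
    by eventually_elim (use fin in \<open>simp add: enn2real_leI ennreal_le_iff2 flip: ennreal_le_iff\<close>)
  then show "\<exists>C. AE x in M. \<bar>f x\<bar> \<le> C" by blast
next
  assume "\<exists>C. AE x in M. \<bar>f x\<bar> \<le> C"
  then obtain C where "AE x in M. \<bar>f x\<bar> \<le> C" by blast
  then have "AE x in M. ennreal \<bar>f x\<bar> \<le> ennreal C"
    by eventually_elim (rule ennreal_leI)
  then have "esssup M (\<lambda>x. ennreal \<bar>f x\<bar>) \<le> ennreal C"
    using assms by (intro esssup_I) auto
  also have "\<dots> < \<infinity>" by simp
  finally show "f \<in> lp_space M \<infinity>"
    using assms by (simp add: lp_space_def lp_norm_def)
qed


section \<open>Semiparametric Fisher information\<close>

text \<open>\<open>T\<close> is the tangent space, \<open>A\<close> the score operator into \<open>L\<^sub>2(P)\<close> and \<open>D\<close> the gradient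
  of the parameter of interest. In \<^typ>\<open>ennreal\<close> the infimum of the empty set is \<open>\<infinity>\<close>.\<close>

definition semiparametric_information ::
  "'a measure \<Rightarrow> 't set \<Rightarrow> ('t \<Rightarrow> 'a \<Rightarrow> real) \<Rightarrow> ('t \<Rightarrow> real) \<Rightarrow> ennreal" where
  "semiparametric_information P T A D =
     (INF \<alpha>\<in>{\<alpha> \<in> T. D \<alpha> \<noteq> 0}. (lp_norm P 2 (A \<alpha>))\<^sup>2 / ennreal (\<bar>D \<alpha>\<bar>\<^sup>2))"


section \<open>The deviation model\<close>

definition deviation_density :: "('a \<Rightarrow> real) \<Rightarrow> ('a \<Rightarrow> real) \<Rightarrow> 'a \<Rightarrow> real" where
  "deviation_density p0 dev x = p0 x * (1 + dev x)"

definition mean_parameter :: "'a measure \<Rightarrow> ('a \<Rightarrow> real) \<Rightarrow> ('a \<Rightarrow> real) \<Rightarrow> ('a \<Rightarrow> real) \<Rightarrow> real" where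
  "mean_parameter \<mu> p0 g dev = (\<integral>x. g x * deviation_density p0 dev x \<partial>\<mu>)"

definition deviation_score :: "('a \<Rightarrow> real) \<Rightarrow> 'a \<Rightarrow> real" where
  "deviation_score \<alpha> = \<alpha>"

definition mean_gradient :: "'a measure \<Rightarrow> ('a \<Rightarrow> real) \<Rightarrow> ('a \<Rightarrow> real) \<Rightarrow> ('a \<Rightarrow> real) \<Rightarrow> real" where
  "mean_gradient \<mu> p0 g \<alpha> = (\<integral>x. \<alpha> x * g x * p0 x \<partial>\<mu>)"

text \<open>The following facts tie the score and the gradient to the model: the score is the
  derivative of the log-density along the path \<open>t \<mapsto> t\<alpha>\<close>, the integral defining the gradient
  converges on the whole tangent space, and the gradient is the derivative of the parameter
  along such a path.\<close>

lemma deviation_score_is_score: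
  assumes "p0 x > 0"
  shows "((\<lambda>t. ln (deviation_density p0 (\<lambda>y. t * \<alpha> y) x))
           has_real_derivative deviation_score \<alpha> x) (at 0)"
  using assms unfolding deviation_density_def deviation_score_def
  by (auto intro!: derivative_eq_intros)

lemma mean_parameter_0:
  assumes "p0 \<in> borel_measurable \<mu>" "\<And>x. x \<in> space \<mu> \<Longrightarrow> 0 \<le> p0 x"
    and "g \<in> borel_measurable \<mu>"
  shows "mean_parameter \<mu> p0 g (\<lambda>_. 0) = (\<integral>x. g x \<partial>density \<mu> p0)"
  using assms by (subst integral_density)
    (auto simp: mean_parameter_def deviation_density_def mult.commute)

lemma lp_dual_integrable:
  assumes P: "prob_space P" and q: "1 \<le> q" "q \<le> 2" and conj: "1 / q + 1 / q' = 1"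
    and f: "f \<in> lp_space P q'" and g: "g \<in> lp_space P q"
  shows "integrable P (\<lambda>x. f x * g x)"
proof -
  have fm [measurable]: "f \<in> borel_measurable P" and gm [measurable]: "g \<in> borel_measurable P"
    using f g by (auto simp: lp_space_def)
  have qfin: "q \<noteq> \<infinity>" using q(2) by (auto simp: top_unique)
  define r where "r = enn2real q"
  have qr: "q = ennreal r" using qfin by (simp add: r_def less_top)
  have r: "1 \<le> r"
    using q(1) by (simp add: qr ennreal_le_iff2 flip: ennreal_1 del: ennreal_1)
  have gi: "integrable P (\<lambda>x. \<bar>g x\<bar> powr r)"
    using g qfin by (simp add: lp_space_finite_exponent r_def)
  show ?thesis
  proof (cases "q' = \<infinity>")
    case True
    have "ennreal (1 / r) = 1 / q"
      unfolding qr using r divide_ennreal[of 1 r] by (metis ennreal_1 less_le_trans zero_le_one zero_less_one)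
    also have "\<dots> = 1" using conj True by simp
    finally have "1 / r = 1" using r by (simp only: ennreal_eq_1)
    then have r1: "r = 1" using r by (simp add: field_simps)
    then have g1: "integrable P g" using gi by (simp add: r1 integrable_abs_iff)
    obtain C where C: "AE x in P. \<bar>f x\<bar> \<le> C"
      using f lp_space_infinite_exponent[OF fm] True by auto
    show ?thesis
    proof (rule Bochner_Integration.integrable_bound)
      show "integrable P (\<lambda>x. C * g x)" using g1 by simp
      show "AE x in P. norm (f x * g x) \<le> norm (C * g x)"
        using C by eventually_elim (auto simp: abs_mult intro!: mult_right_mono)
    qed simp
  next
    case False
    define s where "s = enn2real q'"
    have qs: "q' = ennreal s" using False by (simp add: s_def less_top)
    have s0: "s > 0"
    proof (rule ccontr)
      assume "\<not> s > 0"
      then have "q' = 0" by (simp add: qs ennreal_neg)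
      with conj show False by simp
    qed
    have "ennreal (1 / r + 1 / s) = ennreal (1 / r) + ennreal (1 / s)"
      by (rule ennreal_plus) (use r s0 in auto)
    also have "ennreal (1 / r) = 1 / q"
      unfolding qr using r divide_ennreal[of 1 r] by (metis ennreal_1 less_le_trans zero_le_one zero_less_one)
    also have "ennreal (1 / s) = 1 / q'"
      unfolding qs using s0 divide_ennreal[of 1 s] by (metis ennreal_1 zero_le_one)
    also note conj
    finally have rs: "1 / r + 1 / s = 1" by (simp only: ennreal_eq_1)
    have "1 / r > 0" "1 / s > 0" using r s0 by auto
    then have "1 / r < 1" "1 / s < 1" using rs by linarith+
    then have r1: "r > 1" and s1: "s > 1" using r s0 by (simp_all add: field_simps)
    have fi: "integrable P (\<lambda>x. \<bar>f x\<bar> powr s)"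
      using f False by (simp add: lp_space_finite_exponent s_def)
    show ?thesis
    proof (rule Bochner_Integration.integrable_bound)
      show "integrable P (\<lambda>x. \<bar>f x\<bar> powr s / s + \<bar>g x\<bar> powr r / r)"
        using fi gi by simp
      have "\<bar>f x\<bar> * \<bar>g x\<bar> \<le> \<bar>f x\<bar> powr s / s + \<bar>g x\<bar> powr r / r" for x
        using Youngs_inequality[of s r "\<bar>f x\<bar>" "\<bar>g x\<bar>"] rs r1 s1 by (simp add: add.commute)
      then show "AE x in P. norm (f x * g x) \<le> norm (\<bar>f x\<bar> powr s / s + \<bar>g x\<bar> powr r / r)"
        by (intro AE_I2) (simp add: abs_mult order_trans[OF _ abs_ge_self])
    qed simp
  qed
qed

lemma mean_gradient_is_derivative:
  assumes p0: "p0 \<in> borel_measurable \<mu>" "\<And>x. x \<in> space \<mu> \<Longrightarrow> 0 \<le> p0 x"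
    and P: "prob_space (density \<mu> p0)"
    and q: "1 \<le> q" "q \<le> 2" and conj: "1 / q + 1 / q' = 1"
    and g: "g \<in> lp_space (density \<mu> p0) q" and a: "\<alpha> \<in> lp_space (density \<mu> p0) q'"
  shows "integrable \<mu> (\<lambda>x. \<alpha> x * g x * p0 x)"
    and "((\<lambda>t. mean_parameter \<mu> p0 g (\<lambda>x. t * \<alpha> x))
           has_real_derivative mean_gradient \<mu> p0 g \<alpha>) (at 0)"
proof -
  have one: "(\<lambda>_. 1) \<in> lp_space (density \<mu> p0) q'"
  proof (cases "q' = \<infinity>")
    case True
    have "(\<lambda>_. 1) \<in> lp_space (density \<mu> p0) \<infinity>"
      by (subst lp_space_infinite_exponent) (auto intro!: exI[of _ 1])
    then show ?thesis using True by simp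
  next
    case False
    interpret prob_space "density \<mu> p0" by (rule P)
    show ?thesis using False by (simp add: lp_space_finite_exponent)
  qed
  have [measurable]: "\<alpha> \<in> borel_measurable \<mu>" "g \<in> borel_measurable \<mu>"
    using a g by (auto simp: lp_space_def)
  have *: "integrable \<mu> (\<lambda>x. f x * g x * p0 x)" if "f \<in> lp_space (density \<mu> p0) q'" for f
  proof -
    have [measurable]: "f \<in> borel_measurable \<mu>" using that by (auto simp: lp_space_def)
    have "integrable (density \<mu> p0) (\<lambda>x. f x * g x)"
      using lp_dual_integrable[OF P q conj that g] .
    then show ?thesis
      using p0 by (subst (asm) integrable_density) (auto simp: mult.commute mult.left_commute)
  qed
  show i: "integrable \<mu> (\<lambda>x. \<alpha> x * g x * p0 x)" by (rule *[OF a])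
  have i1: "integrable \<mu> (\<lambda>x. g x * p0 x)" using *[OF one] by simp
  have "mean_parameter \<mu> p0 g (\<lambda>x. t * \<alpha> x)
      = (\<integral>x. g x * p0 x \<partial>\<mu>) + t * mean_gradient \<mu> p0 g \<alpha>" for t
  proof -
    have "mean_parameter \<mu> p0 g (\<lambda>x. t * \<alpha> x)
        = (\<integral>x. g x * p0 x + t * (\<alpha> x * g x * p0 x) \<partial>\<mu>)"
      unfolding mean_parameter_def deviation_density_def
      by (rule Bochner_Integration.integral_cong) (auto simp: algebra_simps)
    also have "\<dots> = (\<integral>x. g x * p0 x \<partial>\<mu>) + t * mean_gradient \<mu> p0 g \<alpha>"
      using i i1 by (simp add: mean_gradient_def)
    finally show ?thesis .
  qed
  then show "((\<lambda>t. mean_parameter \<mu> p0 g (\<lambda>x. t * \<alpha> x))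
           has_real_derivative mean_gradient \<mu> p0 g \<alpha>) (at 0)"
    by (auto intro!: derivative_eq_intros)
qed

end

theory Submission
  imports Defs
begin

text \<open>If \<open>g\<close> is square integrable, the Cauchy--Schwarz inequality bounds every quotient in the
  infimum from below by \<open>1 / E[g\<^sup>2]\<close>. Conversely, the truncations of \<open>g\<close> to \<open>\<bar>g\<bar> \<le> n\<close> are bounded,
  hence tangent vectors for every \<open>q'\<close>, and the quotient at such a truncation is the reciprocal of
  its second moment; positive information therefore bounds these second moments, and monotone
  convergence bounds that of \<open>g\<close>.\<close>

text \<open>Squaring undoes the real root in the finite case and preserves \<infinity> otherwise, so
  the quotients can be handled as nonnegative integrals without integrability conditions.\<close>

lemma lp_norm_2_squared: "(lp_norm M 2 f)\<^sup>2 = (\<integral>\<^sup>+x. ennreal ((f x)\<^sup>2) \<partial>M)"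
proof -
  define I where "I = (\<integral>\<^sup>+x. ennreal ((f x)\<^sup>2) \<partial>M)"
  have "\<bar>y\<bar> powr 2 = y\<^sup>2" for y :: real
    by (cases "y = 0") (auto simp: powr_numeral)
  then have norm: "lp_norm M 2 f = (if I = \<infinity> then \<infinity> else ennreal (enn2real I powr (1 / 2)))"
    by (simp add: lp_norm_def I_def Let_def enn2real_numeral)
  show ?thesis
  proof (cases "I = \<infinity>")
    case True
    then show ?thesis
      using norm I_def by (simp add: power2_eq_square ennreal_top_mult)
  next
    case False
    then have "(lp_norm M 2 f)\<^sup>2 = ennreal ((enn2real I powr (1 / 2))\<^sup>2)"
      using norm by (simp add: ennreal_power)
    also have "(enn2real I powr (1 / 2))\<^sup>2 = enn2real I"
      by (simp add: powr_half_sqrt)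
    finally show ?thesis
      using False I_def by (simp add: less_top)
  qed
qed

lemma lp_space_2_iff_nn_integral:
  "f \<in> lp_space M 2 \<longleftrightarrow> f \<in> borel_measurable M \<and> (\<integral>\<^sup>+x. ennreal ((f x)\<^sup>2) \<partial>M) < \<infinity>"
  by (auto simp: lp_space_2 integrable_iff_bounded)

text \<open>A constant dominates every power of a bounded function and is integrable for a finite
  measure. This admits the truncations of \<open>g\<close> as tangent vectors.\<close>

lemma (in finite_measure) bounded_in_lp_space:
  assumes [measurable]: "f \<in> borel_measurable M" and B: "\<And>x. x \<in> space M \<Longrightarrow> \<bar>f x\<bar> \<le> B"
  shows "f \<in> lp_space M r"
proof (cases "r = \<infinity>")
  case True
  have "f \<in> lp_space M \<infinity>"
    using B by (subst lp_space_infinite_exponent) auto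
  then show ?thesis
    using True by simp
next
  case False
  have "integrable M (\<lambda>x. \<bar>f x\<bar> powr enn2real r)"
    by (rule integrable_const_bound[where B = "B powr enn2real r"])
      (use B in \<open>auto intro!: AE_I2 powr_mono2\<close>)
  then show ?thesis
    using False by (simp add: lp_space_finite_exponent)
qed

text \<open>Cauchy-Schwarz for nonnegative integrals. If \<open>f * g\<close> is not integrable, the
  Bochner integral takes its default value 0 and the bound is trivial.\<close>

lemma squared_integral_mult_le:
  fixes f g :: "'a \<Rightarrow> real"
  assumes [measurable]: "f \<in> borel_measurable M" "g \<in> borel_measurable M"
  shows "ennreal (\<bar>\<integral>x. f x * g x \<partial>M\<bar>\<^sup>2)
    \<le> (\<integral>\<^sup>+x. ennreal ((f x)\<^sup>2) \<partial>M) * (\<integral>\<^sup>+x. ennreal ((g x)\<^sup>2) \<partial>M)"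
proof -
  have "ennreal \<bar>\<integral>x. f x * g x \<partial>M\<bar> \<le> (\<integral>\<^sup>+x. ennreal \<bar>f x\<bar> * ennreal \<bar>g x\<bar> \<partial>M)"
    using integral_norm_bound_ennreal[of M "\<lambda>x. f x * g x"]
    by (cases "integrable M (\<lambda>x. f x * g x)")
      (auto simp: abs_mult ennreal_mult not_integrable_integral_eq)
  then have "(ennreal \<bar>\<integral>x. f x * g x \<partial>M\<bar>)\<^sup>2
      \<le> (\<integral>\<^sup>+x. ennreal \<bar>f x\<bar> * ennreal \<bar>g x\<bar> \<partial>M)\<^sup>2"
    by (rule power_mono) simp
  also have "\<dots> \<le> (\<integral>\<^sup>+x. (ennreal \<bar>f x\<bar>)\<^sup>2 \<partial>M) * (\<integral>\<^sup>+x. (ennreal \<bar>g x\<bar>)\<^sup>2 \<partial>M)"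
    by (rule Cauchy_Schwarz_nn_integral) auto
  finally show ?thesis
    by (simp add: ennreal_power)
qed

lemma mean_gradient_eq_integral_density:
  assumes "p0 \<in> borel_measurable \<mu>" "\<And>x. x \<in> space \<mu> \<Longrightarrow> 0 \<le> p0 x"
    and "g \<in> borel_measurable \<mu>" "\<alpha> \<in> borel_measurable \<mu>"
  shows "mean_gradient \<mu> p0 g \<alpha> = (\<integral>x. \<alpha> x * g x \<partial>density \<mu> p0)"
  using assms by (subst integral_density) (auto simp: mean_gradient_def mult_ac)

text \<open>The exponent \<open>r\<close> enters only through two facts: the space contains the
  bounded measurable functions, and its elements are measurable.\<close>

lemma (in finite_measure) information_pos_iff_square_integrable:
  fixes D :: "('a \<Rightarrow> real) \<Rightarrow> real"
  assumes g [measurable]: "g \<in> borel_measurable M"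
    and D: "\<And>\<alpha>. \<alpha> \<in> borel_measurable M \<Longrightarrow> D \<alpha> = (\<integral>x. \<alpha> x * g x \<partial>M)"
  shows "semiparametric_information M (lp_space M r) deviation_score D > 0 \<longleftrightarrow> g \<in> lp_space M 2"
proof -
  define J where "J = semiparametric_information M (lp_space M r) deviation_score D"
  have J: "J = (INF \<alpha>\<in>{\<alpha> \<in> lp_space M r. D \<alpha> \<noteq> 0}.
      (\<integral>\<^sup>+x. ennreal ((\<alpha> x)\<^sup>2) \<partial>M) / ennreal (\<bar>D \<alpha>\<bar>\<^sup>2))"
    by (simp add: J_def semiparametric_information_def lp_norm_2_squared deviation_score_def)
  show ?thesis
  proof
    assume "semiparametric_information M (lp_space M r) deviation_score D > 0"
    then have pos: "J > 0"
      by (simp add: J_def)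
    \<comment> \<open>Large values are replaced by 0 rather than clipped to the level
      \<open>n\<close>: thus \<open>h n * g\<close> is the square of \<open>h n\<close>, and the
      gradient at \<open>h n\<close> is exactly the second moment of \<open>h n\<close>.\<close>
    define h where "h n x = (if \<bar>g x\<bar> \<le> real n then g x else 0)" for n x
    have [measurable]: "h n \<in> borel_measurable M" for n
      unfolding h_def by measurable
    have h_bounded: "\<bar>h n x\<bar> \<le> real n" for n x
      by (simp add: h_def)
    have bound: "(\<integral>\<^sup>+x. ennreal ((h n x)\<^sup>2) \<partial>M) \<le> inverse J" for n
    proof -
      define S where "S = (\<integral>x. (h n x)\<^sup>2 \<partial>M)"
      have "integrable M (\<lambda>x. (h n x)\<^sup>2)"
        by (rule integrable_const_bound[where B = "(real n)\<^sup>2"])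
          (auto simp: h_bounded simp flip: abs_le_square_iff)
      then have S: "(\<integral>\<^sup>+x. ennreal ((h n x)\<^sup>2) \<partial>M) = ennreal S"
        by (simp add: S_def nn_integral_eq_integral)
      have "D (h n) = (\<integral>x. h n x * g x \<partial>M)"
        by (rule D) measurable
      also have "\<dots> = S"
        unfolding S_def
        by (rule Bochner_Integration.integral_cong) (auto simp: h_def power2_eq_square)
      finally have DS: "D (h n) = S" .
      \<comment> \<open>For \<open>S = 0\<close> the gradient vanishes at \<open>h n\<close>, so
        \<open>h n\<close> is outside the index set of the infimum; the bound then holds because its
        left side is 0.\<close>
      show ?thesis
      proof (cases "S = 0")
        case True
        then show ?thesis
          by (simp add: S)
      next
        case False
        then have "S > 0"
          by (simp add: S_def less_le)
        have "h n \<in> lp_space M r"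
          by (rule bounded_in_lp_space[where B = "real n"]) (auto simp: h_bounded)
        then have "J \<le> (\<integral>\<^sup>+x. ennreal ((h n x)\<^sup>2) \<partial>M) / ennreal (\<bar>D (h n)\<bar>\<^sup>2)"
          unfolding J using False DS by (intro INF_lower) auto
        also have "\<dots> = ennreal S / ennreal (\<bar>S\<bar>\<^sup>2)"
          by (simp only: S DS)
        also have "\<dots> = inverse (ennreal S)"
          using \<open>S > 0\<close> by (simp add: divide_ennreal inverse_ennreal power2_eq_square field_simps)
        finally have "J \<le> inverse (ennreal S)" .
        \<comment> \<open>Since \<open>S > 0\<close>, the inverse of \<open>S\<close> is finite,
          which rules out \<open>J = \<infinity>\<close>; what remains is inversion of positive
          reals.\<close>
        then show ?thesis
          unfolding S using pos \<open>S > 0\<close>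
          by (cases J) (auto simp: inverse_ennreal field_simps top_unique)
      qed
    qed
    \<comment> \<open>At each point the supremum is attained, by any \<open>n\<close> with
      \<open>\<bar>g x\<bar> \<le> n\<close>.\<close>
    have "(\<integral>\<^sup>+x. ennreal ((g x)\<^sup>2) \<partial>M) = (\<integral>\<^sup>+x. (SUP n. ennreal ((h n x)\<^sup>2)) \<partial>M)"
    proof (rule nn_integral_cong)
      fix x
      obtain n where "\<bar>g x\<bar> \<le> real n"
        using real_arch_simple by blast
      then have "ennreal ((g x)\<^sup>2) = ennreal ((h n x)\<^sup>2)"
        by (simp add: h_def)
      moreover have "ennreal ((h m x)\<^sup>2) \<le> ennreal ((g x)\<^sup>2)" for m
        by (simp add: h_def)
      ultimately show "ennreal ((g x)\<^sup>2) = (SUP n. ennreal ((h n x)\<^sup>2))"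
        by (intro antisym SUP_least) (auto intro: SUP_upper2)
    qed
    also have "\<dots> = (SUP n. \<integral>\<^sup>+x. ennreal ((h n x)\<^sup>2) \<partial>M)"
      by (rule nn_integral_monotone_convergence_SUP)
        (auto simp: incseq_def le_fun_def h_def)
    also have "\<dots> \<le> inverse J"
      by (rule SUP_least) (rule bound)
    also have "\<dots> < \<infinity>"
      using pos by (simp flip: top.not_eq_extremum)
    finally show "g \<in> lp_space M 2"
      by (simp add: lp_space_2_iff_nn_integral)
  next
    assume "g \<in> lp_space M 2"
    define G where "G = (\<integral>\<^sup>+x. ennreal ((g x)\<^sup>2) \<partial>M)"
    have "G < \<infinity>"
      using \<open>g \<in> lp_space M 2\<close> by (simp add: G_def lp_space_2_iff_nn_integral)
    \<comment> \<open>This includes \<open>G = 0\<close>, where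
      \<open>inverse G = \<infinity>\<close>: then \<open>g\<close> vanishes almost everywhere,
      \<open>D\<close> is zero on the whole space, and the infimum is over the empty set.\<close>
    have "inverse G \<le> J"
      unfolding J
    proof (rule INF_greatest)
      fix \<alpha> assume "\<alpha> \<in> {\<alpha> \<in> lp_space M r. D \<alpha> \<noteq> 0}"
      then have [measurable]: "\<alpha> \<in> borel_measurable M" and "D \<alpha> \<noteq> 0"
        by (auto simp: lp_space_def)
      define N where "N = (\<integral>\<^sup>+x. ennreal ((\<alpha> x)\<^sup>2) \<partial>M)"
      define d where "d = ennreal (\<bar>D \<alpha>\<bar>\<^sup>2)"
      have d: "0 < d" "d < \<infinity>"
        using \<open>D \<alpha> \<noteq> 0\<close> by (auto simp: d_def)
      have "d \<le> N * G"
        using squared_integral_mult_le[of \<alpha> M g] by (simp add: d_def N_def G_def D)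
      \<comment> \<open>In \<open>ennreal\<close> the product \<open>N * 0\<close> is 0 even for
        infinite \<open>N\<close>, against \<open>d > 0\<close>. The cancellations below need both
        \<open>d\<close> and \<open>G\<close> positive and finite.\<close>
      then have "G \<noteq> 0"
        using d by auto
      have "inverse G = d * inverse G / d"
        using d by (metis ennreal_mult_divide_eq infinity_ennreal_def less_irrefl mult.commute)
      also have "\<dots> \<le> (N * G) * inverse G / d"
        using \<open>d \<le> N * G\<close> by (intro divide_right_mono_ennreal mult_right_mono) auto
      also have "\<dots> = N / d"
        using \<open>G \<noteq> 0\<close> \<open>G < \<infinity>\<close> by (simp add: ennreal_mult_divide_eq flip: divide_ennreal_def)
      finally show "inverse G \<le> (\<integral>\<^sup>+x. ennreal ((\<alpha> x)\<^sup>2) \<partial>M) / ennreal (\<bar>D \<alpha>\<bar>\<^sup>2)"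
        by (simp add: N_def d_def)
    qed
    moreover have "inverse G > 0"
      using \<open>G < \<infinity>\<close> by (simp add: ennreal_inverse_positive)
    ultimately show "semiparametric_information M (lp_space M r) deviation_score D > 0"
      by (simp add: J_def)
  qed
qed

theorem mainTheorem2:
  fixes \<mu> P0 :: "'a measure" and p0 g :: "'a \<Rightarrow> real" and q q' :: ennreal
  assumes "sigma_finite_measure \<mu>"
    and "p0 \<in> borel_measurable \<mu>"
    and "\<And>x. x \<in> space \<mu> \<Longrightarrow> 0 \<le> p0 x"
    and "P0 = density \<mu> (\<lambda>x. ennreal (p0 x))"
    and "prob_space P0"
    and "1 \<le> q" and "q \<le> 2" and "1 / q + 1 / q' = 1"
    and "g \<in> lp_space P0 q"
  shows "semiparametric_information P0 (lp_space P0 q') deviation_score (mean_gradient \<mu> p0 g) > 0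
         \<longleftrightarrow> g \<in> lp_space P0 2"
proof -
  interpret prob_space P0 by fact
  have g: "g \<in> borel_measurable P0"
    using \<open>g \<in> lp_space P0 q\<close> by (simp add: lp_space_def)
  show ?thesis
  \<comment> \<open>It remains to pass from the gradient as an integral against \<open>\<mu>\<close>
    to one against \<open>P0\<close>.\<close>
  proof (rule information_pos_iff_square_integrable[OF g])
    fix \<alpha> :: "'a \<Rightarrow> real" assume "\<alpha> \<in> borel_measurable P0"
    then show "mean_gradient \<mu> p0 g \<alpha> = (\<integral>x. \<alpha> x * g x \<partial>P0)"
      using assms(2-4) g by (simp add: mean_gradient_eq_integral_density)
  qed
qed

end
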